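(* Let $T_N$ be the ordinary Chebyshev polynomial of the first kind of degree $N$, with zeros $x_1^{(N)},\dots,x_N^{(N)}$, and let $m_{2l}^{(T)}(N)=\frac1N\sum_{i=1}^N (x_i^{(N)})^{2l}=\frac2N\sum_{k=1}^{\lfloor N/2\rfloor}\cos^{2l}\!\left(\frac{2k-1}{2N}\pi\right)$. Then for all integers $l\ge1$, $M\ge1$: $$m_{2l}^{(T)}(2M)=2^{-(2-\frac1M)l}\;T_l^{(M-1)}\bigl(e_1(2M),\dots,e_{M-1}(2M)\bigr),\qquad e_k(2M)=\frac{2M}{k}\,2^{-k/M}\binom{2M-k-1}{k-1},$$ $$m_{2l}^{(T)}(2M+1)=\frac{2M}{2M+1}\left(\frac{(2M+1)^{1/M}}{4}\right)^{l}T_l^{(M-1)}\bigl(e_1(2M+1),\dots,e_{M-1}(2M+1)\bigr),$$ $$e_k(2M+1)=\frac{2M+1}{k}\,\frac{1}{(2M+1)^{k/M}}\binom{2M-k}{k-1},\qquad k=1,\dots,M-1,$$ and $m_0^{(T)}(N)=1$ for all $N\ge 1$, where $m_0^{(T)}(N)=\frac1N\sum_{i=1}^N1$, and $m_{2l}^{(T)}(1)=0$ for $l\ge1$.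
   Context: For integers $n\ge1$, $r\ge0$, $t_r^{(n)}(s_1,\dots,s_n)$ denotes the unique polynomial such that $t_r^{(n)}(s_1,\dots,s_n)=\frac1n\sum_{i=1}^n y_i^r$ whenever $s_1,\dots,s_n$ are the elementary symmetric functions of $y_1,\dots,y_n$. The $(n-1)$-variable generalized Chebyshev polynomial of the first kind is $T_r^{(n-1)}(s_1,\dots,s_{n-1})=t_r^{(n)}(s_1,\dots,s_{n-1},1)$; in particular $T_r^{(0)}=1$ and $T_r^{(1)}(2x)=T_r(x)$. Fractional powers of positive reals are the positive real ones. In the cosine-sum expression an empty sum is $0$; that expression is meant for $l\ge1$. *)

theory Defs
  imports
    Complex_Main
    "HOL-Library.Poly_Mapping"
    "HOL-Computational_Algebra.Polynomial"
begin

text \<open>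
  Real polynomials in commuting variables indexed by natural numbers: finitely supported
  families of coefficients, where a monomial is a finitely supported family of exponents.
\<close>

type_synonym mvpoly = "(nat \<Rightarrow>\<^sub>0 nat) \<Rightarrow>\<^sub>0 real"

definition mv_vars :: "mvpoly \<Rightarrow> nat set" where
  "mv_vars p = (\<Union>m\<in>Poly_Mapping.keys p. Poly_Mapping.keys m)"

definition mv_eval :: "mvpoly \<Rightarrow> (nat \<Rightarrow> 'a::real_normed_field) \<Rightarrow> 'a" where
  "mv_eval p s =
     (\<Sum>m\<in>Poly_Mapping.keys p.
        of_real (Poly_Mapping.lookup p m) *
        (\<Prod>i\<in>Poly_Mapping.keys m. s i ^ Poly_Mapping.lookup m i))"

definition elem_sym :: "nat \<Rightarrow> (nat \<Rightarrow> 'a::comm_ring_1) \<Rightarrow> nat \<Rightarrow> 'a" where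
  "elem_sym n y k = (\<Sum>A | A \<subseteq> {1..n} \<and> card A = k. \<Prod>i\<in>A. y i)"

text \<open>
  For \<open>n \<ge> 1\<close>, the polynomial in the variables \<open>s\<^sub>1, \<dots>, s\<^sub>n\<close> that expresses the
  \<open>r\<close>-th mean power sum of \<open>y\<^sub>1, \<dots>, y\<^sub>n\<close> through their elementary symmetric functions.
  The coefficients are real (in fact rational), while the \<open>y\<^sub>i\<close> range over the complex
  numbers, so that every tuple of values of the \<open>s\<^sub>k\<close> is attained.
\<close>

definition mean_power_poly :: "nat \<Rightarrow> nat \<Rightarrow> mvpoly" where
  "mean_power_poly n r =
     (THE p. mv_vars p \<subseteq> {1..n} \<and>
        (\<forall>y :: nat \<Rightarrow> complex.
           mv_eval p (elem_sym n y) = (\<Sum>i = 1..n. y i ^ r) / of_nat n))"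

text \<open>
  The generalized Chebyshev polynomial of the first kind in \<open>k = n - 1\<close> variables, as a function
  of \<open>s\<^sub>1, \<dots>, s\<^sub>k\<close>; the values of \<open>s\<close> outside \<open>{1..k}\<close> are irrelevant.
\<close>

definition gen_cheb_T :: "nat \<Rightarrow> nat \<Rightarrow> (nat \<Rightarrow> real) \<Rightarrow> real" where
  "gen_cheb_T k r s = mv_eval (mean_power_poly (Suc k) r) (s(Suc k := 1))"

fun cheb_T :: "nat \<Rightarrow> real poly" where
  "cheb_T 0 = 1"
| "cheb_T (Suc 0) = [:0, 1:]"
| "cheb_T (Suc (Suc n)) = [:0, 2:] * cheb_T (Suc n) - cheb_T n"

text \<open>The zeros are taken with multiplicity; all of them are real.\<close>

definition cheb_moment :: "nat \<Rightarrow> nat \<Rightarrow> real" where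
  "cheb_moment r N = (\<Sum>x\<in>#proots (cheb_T N). x ^ r) / real N"

end

theory Submission
  imports
    Defs
    "HOL-Computational_Algebra.Formal_Power_Series"
    "HOL-Computational_Algebra.Fundamental_Theorem_Algebra"
begin

text \<open>
  Write \<open>T\<^sub>N(x) = 2\<^sup>N\<^sup>-\<^sup>1 x\<^sup>d U(x\<^sup>2)\<close> with \<open>d = N mod 2\<close> and \<open>U\<close> monic of degree \<open>M = N div 2\<close>. The roots
  of \<open>U\<close> are the squares of the positive zeros of \<open>T\<^sub>N\<close>, so Vieta's formulas and the explicit
  coefficients of \<open>T\<^sub>N\<close> give their elementary symmetric functions. Rescaling the roots so that
  their product becomes \<open>1\<close> turns their mean \<open>l\<close>-th power into a value of \<open>T\<^sub>l\<close> in \<open>M - 1\<close> variables.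
  The defining property of that polynomial is available because power sums are polynomials in the
  elementary symmetric functions (Newton), and uniquely so since over the complex numbers the
  elementary symmetric functions take all values (fundamental theorem of algebra) and a polynomial
  vanishing everywhere is zero.
\<close>

section \<open>Polynomials in several variables as functions\<close>

definition mono_eval :: "(nat \<Rightarrow>\<^sub>0 nat) \<Rightarrow> (nat \<Rightarrow> 'a::comm_semiring_1) \<Rightarrow> 'a" where
  "mono_eval m s = (\<Prod>i\<in>Poly_Mapping.keys m. s i ^ Poly_Mapping.lookup m i)"

lemma mono_eval_superset:
  assumes "finite V" "Poly_Mapping.keys m \<subseteq> V"
  shows "mono_eval m s = (\<Prod>i\<in>V. s i ^ Poly_Mapping.lookup m i)"
  unfolding mono_eval_def using assms
  by (intro prod.mono_neutral_left) (auto simp: in_keys_iff)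

lemma mono_eval_add: "mono_eval (m + m') s = mono_eval m s * mono_eval m' s"
proof -
  let ?V = "Poly_Mapping.keys m \<union> Poly_Mapping.keys m'"
  have "mono_eval (m + m') s = (\<Prod>i\<in>?V. s i ^ Poly_Mapping.lookup (m + m') i)"
    using Poly_Mapping.keys_add[of m m'] by (intro mono_eval_superset) auto
  also have "\<dots> = mono_eval m s * mono_eval m' s"
    by (simp add: mono_eval_superset[of ?V m] mono_eval_superset[of ?V m']
        lookup_add power_add prod.distrib)
  finally show ?thesis .
qed

lemma mono_eval_single: "mono_eval (Poly_Mapping.single k 1) s = s k"
  by (simp add: mono_eval_def)

text \<open>Monomials are eigenvectors of the substitution that scales one variable. The eigenvalue
  records the exponent, which is what separates distinct monomials below.\<close>

lemma mono_eval_scale_var: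
  "mono_eval m (s(i := c * s i)) = c ^ Poly_Mapping.lookup m i * mono_eval m s"
proof -
  let ?V = "insert i (Poly_Mapping.keys m)"
  have "mono_eval m (s(i := c * s i)) = (\<Prod>j\<in>?V. (s(i := c * s i)) j ^ Poly_Mapping.lookup m j)"
    by (intro mono_eval_superset) auto
  also have "\<dots> = (\<Prod>j\<in>?V. (if j = i then c ^ Poly_Mapping.lookup m i else 1) *
                      s j ^ Poly_Mapping.lookup m j)"
    by (intro prod.cong) (auto simp: power_mult_distrib)
  also have "\<dots> = c ^ Poly_Mapping.lookup m i * (\<Prod>j\<in>?V. s j ^ Poly_Mapping.lookup m j)"
    unfolding prod.distrib by (simp add: prod.delta)
  also have "(\<Prod>j\<in>?V. s j ^ Poly_Mapping.lookup m j) = mono_eval m s"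
    by (intro mono_eval_superset[symmetric]) auto
  finally show ?thesis .
qed

lemma mv_eval_superset:
  assumes "finite K" "Poly_Mapping.keys p \<subseteq> K"
  shows "mv_eval p s = (\<Sum>m\<in>K. of_real (Poly_Mapping.lookup p m) * mono_eval m s)"
  unfolding mv_eval_def mono_eval_def[symmetric] using assms
  by (intro sum.mono_neutral_left) (auto simp: in_keys_iff)

lemma mv_eval_add: "mv_eval (p + q) s = mv_eval p s + mv_eval q s"
proof -
  let ?K = "Poly_Mapping.keys p \<union> Poly_Mapping.keys q"
  have "mv_eval (p + q) s = (\<Sum>m\<in>?K. of_real (Poly_Mapping.lookup (p + q) m) * mono_eval m s)"
    using Poly_Mapping.keys_add[of p q] by (intro mv_eval_superset) auto
  also have "\<dots> = mv_eval p s + mv_eval q s"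
    by (simp add: mv_eval_superset[of ?K p] mv_eval_superset[of ?K q] lookup_add
        algebra_simps sum.distrib)
  finally show ?thesis .
qed

lemma mv_eval_single:
  "mv_eval (Poly_Mapping.single m c) s = of_real c * mono_eval m s"
  by (simp add: mv_eval_superset[of "{m}"])

lemma mv_eval_cong:
  assumes "mv_vars p \<subseteq> V" "\<And>i. i \<in> V \<Longrightarrow> s i = s' i"
  shows "mv_eval p s = mv_eval p s'"
  unfolding mv_eval_def using assms
  by (intro sum.cong prod.cong arg_cong2[where f = "(*)"]) (auto simp: mv_vars_def)

lemma of_real_mv_eval:
  "of_real (mv_eval p s) = (mv_eval p (\<lambda>i. of_real (s i)) :: 'a::real_normed_field)"
  by (simp add: mv_eval_def)

text \<open>Here \<open>\<phi>\<close> supplies values for the variables, later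
  \<open>elem_sym n\<close>. Newton's recursion only requires closure under sums and under
  multiplication by a monomial, so working with representable functions avoids a general product
  rule for \<open>mv_eval\<close>.\<close>

definition mv_expressible :: "nat set \<Rightarrow> ('b \<Rightarrow> nat \<Rightarrow> 'a::real_normed_field) \<Rightarrow> ('b \<Rightarrow> 'a) \<Rightarrow> bool"
  where "mv_expressible V \<phi> g \<longleftrightarrow> (\<exists>p. mv_vars p \<subseteq> V \<and> (\<forall>y. mv_eval p (\<phi> y) = g y))"

lemma mv_expressible_monomial:
  assumes "Poly_Mapping.keys m \<subseteq> V"
  shows "mv_expressible V \<phi> (\<lambda>y. of_real c * mono_eval m (\<phi> y))"
  unfolding mv_expressible_def using assms
  by (intro exI[of _ "Poly_Mapping.single m c"]) (auto simp: mv_eval_single mv_vars_def)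

lemma mv_expressible_const: "mv_expressible V \<phi> (\<lambda>y. of_real c)"
  using mv_expressible_monomial[of 0 V \<phi> c] by (simp add: mono_eval_def)

lemma mv_expressible_add:
  assumes "mv_expressible V \<phi> g" "mv_expressible V \<phi> h"
  shows "mv_expressible V \<phi> (\<lambda>y. g y + h y)"
proof -
  from assms obtain p q where "mv_vars p \<subseteq> V" "mv_vars q \<subseteq> V"
    "\<And>y. mv_eval p (\<phi> y) = g y" "\<And>y. mv_eval q (\<phi> y) = h y"
    unfolding mv_expressible_def by blast
  moreover from this have "mv_vars (p + q) \<subseteq> V"
    using Poly_Mapping.keys_add[of p q] unfolding mv_vars_def by blast
  ultimately show ?thesis
    unfolding mv_expressible_def by (intro exI[of _ "p + q"]) (auto simp: mv_eval_add)
qed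

lemma mv_expressible_sum:
  assumes "\<And>i. i \<in> I \<Longrightarrow> mv_expressible V \<phi> (g i)"
  shows "mv_expressible V \<phi> (\<lambda>y. \<Sum>i\<in>I. g i y)"
  using assms
proof (induction I rule: infinite_finite_induct)
  case (insert i I)
  then have "mv_expressible V \<phi> (\<lambda>y. g i y + (\<Sum>i\<in>I. g i y))"
    by (intro mv_expressible_add) auto
  with insert.hyps show ?case by simp
qed (use mv_expressible_const[of V \<phi> 0] in simp_all)

lemma mv_expressible_mult_monomial:
  assumes "mv_expressible V \<phi> g" "Poly_Mapping.keys k \<subseteq> V"
  shows "mv_expressible V \<phi> (\<lambda>y. of_real c * mono_eval k (\<phi> y) * g y)"
proof -
  from assms(1) obtain p where p: "mv_vars p \<subseteq> V" "\<And>y. mv_eval p (\<phi> y) = g y"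
    unfolding mv_expressible_def by blast
  have "mv_expressible V \<phi> (\<lambda>y. \<Sum>m\<in>Poly_Mapping.keys p.
          of_real (c * Poly_Mapping.lookup p m) * mono_eval (k + m) (\<phi> y))"
  proof (intro mv_expressible_sum mv_expressible_monomial)
    fix m assume "m \<in> Poly_Mapping.keys p"
    with p(1) have "Poly_Mapping.keys m \<subseteq> V" by (auto simp: mv_vars_def)
    with assms(2) show "Poly_Mapping.keys (k + m) \<subseteq> V"
      using Poly_Mapping.keys_add[of k m] by auto
  qed
  also have "(\<lambda>y. \<Sum>m\<in>Poly_Mapping.keys p.
          of_real (c * Poly_Mapping.lookup p m) * mono_eval (k + m) (\<phi> y)) =
        (\<lambda>y. of_real c * mono_eval k (\<phi> y) * g y)"
    by (simp add: p(2)[symmetric] mv_eval_superset[of "Poly_Mapping.keys p" p] mono_eval_add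
        sum_distrib_left mult_ac)
  finally show ?thesis .
qed

lemma mv_expressible_cmult_var_mult:
  assumes "mv_expressible V \<phi> g" "k \<in> V"
  shows "mv_expressible V \<phi> (\<lambda>y. of_real c * \<phi> y k * g y)"
  using mv_expressible_mult_monomial[OF assms(1), of "Poly_Mapping.single k 1" c] assms(2)
  by (simp add: mono_eval_single[unfolded One_nat_def])

text \<open>
  Dedekind's argument for the independence of characters: if two monomials differ in the exponent
  of the variable \<open>i\<close>, then doubling \<open>s i\<close> and subtracting a multiple of the original relation
  eliminates one of them but keeps the other.
\<close>

lemma mono_eval_independent:
  fixes c :: "(nat \<Rightarrow>\<^sub>0 nat) \<Rightarrow> 'a::real_normed_field"
  assumes "finite K" "\<And>s :: nat \<Rightarrow> 'a. (\<Sum>m\<in>K. c m * mono_eval m s) = 0" "m \<in> K"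
  shows "c m = 0"
  using assms
proof (induction K arbitrary: c m rule: finite_induct)
  case (insert m1 K)
  have K0: "c m2 = 0" if m2: "m2 \<in> K" for m2
  proof -
    from m2 insert.hyps have "m2 \<noteq> m1" by auto
    then obtain i where i: "Poly_Mapping.lookup m1 i \<noteq> Poly_Mapping.lookup m2 i"
      using poly_mapping_eqI by metis
    define d where "d m = c m * (2 ^ Poly_Mapping.lookup m i - 2 ^ Poly_Mapping.lookup m1 i)" for m
    have "(\<Sum>m\<in>K. d m * mono_eval m s) = 0" for s :: "nat \<Rightarrow> 'a"
    proof -
      have "(\<Sum>m\<in>insert m1 K. d m * mono_eval m s) =
          (\<Sum>m\<in>insert m1 K. c m * mono_eval m (s(i := 2 * s i))) -
          2 ^ Poly_Mapping.lookup m1 i * (\<Sum>m\<in>insert m1 K. c m * mono_eval m s)"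
        unfolding mono_eval_scale_var d_def
        by (simp only: sum_distrib_left sum_subtractf[symmetric]) (simp add: algebra_simps)
      also have "\<dots> = 0" by (simp only: insert.prems(1) mult_zero_right diff_self)
      finally show ?thesis using insert.hyps by (simp add: d_def)
    qed
    from insert.IH[OF this m2] have "d m2 = 0" .
    moreover have "(2 :: 'a) ^ Poly_Mapping.lookup m2 i \<noteq> 2 ^ Poly_Mapping.lookup m1 i"
    proof
      assume "(2 :: 'a) ^ Poly_Mapping.lookup m2 i = 2 ^ Poly_Mapping.lookup m1 i"
      then have "of_nat (2 ^ Poly_Mapping.lookup m2 i) = (of_nat (2 ^ Poly_Mapping.lookup m1 i) :: 'a)"
        by simp
      then show False using i by (simp only: of_nat_eq_iff) simp
    qed
    ultimately show ?thesis by (simp add: d_def)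
  qed
  \<comment> \<open>At the all-ones point every monomial equals 1, so the relation reduces to the
    one remaining coefficient.\<close>
  have "c m1 = 0"
    using insert.prems(1)[of "\<lambda>_. 1"] insert.hyps K0 by (simp add: mono_eval_def)
  with K0 insert.prems(2) show ?case by auto
qed auto

text \<open>Over the union of the supports, the differences of coefficients form a vanishing
  combination of monomials, to which independence applies.\<close>

lemma mv_eval_inject:
  assumes "\<And>s :: nat \<Rightarrow> 'a::real_normed_field. mv_eval p s = mv_eval q s"
  shows "p = q"
proof (rule poly_mapping_eqI)
  fix m
  let ?K = "Poly_Mapping.keys p \<union> Poly_Mapping.keys q"
  have "(\<Sum>m\<in>?K. of_real (Poly_Mapping.lookup p m - Poly_Mapping.lookup q m) *
          mono_eval m s) = (0 :: 'a)" for s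
    using assms[of s]
    by (simp add: mv_eval_superset[of ?K p] mv_eval_superset[of ?K q] algebra_simps sum_subtractf)
  note * = mono_eval_independent[OF _ this]
  show "Poly_Mapping.lookup p m = Poly_Mapping.lookup q m"
  proof (cases "m \<in> ?K")
    case True
    from *[OF _ this] show ?thesis by (simp flip: of_real_diff)
  qed (auto simp: in_keys_iff)
qed

section \<open>Elementary symmetric functions and power sums\<close>

lemma elem_sym_eq_0: "k > n \<Longrightarrow> elem_sym n y k = 0"
proof -
  assume "k > n"
  then have "{A. A \<subseteq> {1..n} \<and> card A = k} = {}"
    by (auto dest!: card_mono[OF finite_atLeastAtMost])
  then show ?thesis by (simp only: elem_sym_def sum.empty)
qed

lemma elem_sym_0: "elem_sym n y 0 = 1"
proof -
  have "{A. A \<subseteq> {1..n} \<and> card A = 0} = {{}}"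
    by (auto dest: finite_subset[OF _ finite_atLeastAtMost])
  then show ?thesis by (simp add: elem_sym_def)
qed

lemma elem_sym_scale: "elem_sym n (\<lambda>i. c * y i) k = c ^ k * elem_sym n y k"
  by (simp add: elem_sym_def prod.distrib sum_distrib_left)

lemma of_real_elem_sym:
  "of_real (elem_sym n y k) = (elem_sym n (\<lambda>i. of_real (y i)) k :: 'a::{real_algebra_1,comm_ring_1})"
  by (simp add: elem_sym_def)

text \<open>Expand over subsets and group them by cardinality. The ring is left general so that the
  identity can be used for polynomials and for formal power series.\<close>

lemma prod_diff_eq_elem_sym:
  fixes u :: "'a::comm_ring_1"
  shows "(\<Prod>i=1..n. u - w i) = (\<Sum>k\<le>n. (-1) ^ k * elem_sym n w k * u ^ (n - k))"
proof -
  have "(\<Prod>i=1..n. u - w i) =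
      (\<Sum>A\<in>Pow {1..n}. (-1) ^ card A * (\<Prod>i\<in>A. w i) * u ^ (n - card A))"
    by (subst prod_diff_conv_sum)
      (auto intro!: sum.cong simp: card_Diff_subset finite_subset[OF _ finite_atLeastAtMost])
  also have "\<dots> = (\<Sum>k\<le>n. \<Sum>A | A \<in> Pow {1..n} \<and> card A = k.
                     (-1) ^ card A * (\<Prod>i\<in>A. w i) * u ^ (n - card A))"
    by (intro sum.group[symmetric])
      (auto dest: card_mono[OF finite_atLeastAtMost])
  also have "\<dots> = (\<Sum>k\<le>n. (-1) ^ k * elem_sym n w k * u ^ (n - k))"
    by (intro sum.cong) (auto simp: elem_sym_def sum_distrib_left sum_distrib_right)
  finally show ?thesis .
qed

lemma elem_sym_const_poly: "elem_sym n (\<lambda>i. [:y i:]) k = [:elem_sym n y k:]"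
proof -
  have "(\<Prod>i\<in>A. [:y i:]) = [:\<Prod>i\<in>A. y i:]" for A
    by (induction A rule: infinite_finite_induct) auto
  moreover have "(\<Sum>A\<in>B. [:f A:]) = [:\<Sum>A\<in>B. f A:]" for B and f :: "nat set \<Rightarrow> 'a"
    by (induction B rule: infinite_finite_induct) auto
  ultimately show ?thesis by (simp add: elem_sym_def)
qed

lemma coeff_sum_monom_diff:
  assumes "k \<le> n"
  shows "coeff (\<Sum>j\<le>n. monom (a j) (n - j)) (n - k) = a k"
proof -
  have "coeff (\<Sum>j\<le>n. monom (a j) (n - j)) (n - k) = (\<Sum>j\<le>n. if j = k then a j else 0)"
    unfolding coeff_sum using assms by (intro sum.cong) auto
  then show ?thesis using assms by simp
qed

lemma degree_sum_monom_diff_le: "degree (\<Sum>j\<le>n. monom (a j) (n - j)) \<le> n"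
  by (intro degree_sum_le order.trans[OF degree_monom_le]) auto

text \<open>Vieta's formulas: the previous expansion is taken in the polynomial ring, with
  \<open>u\<close> the indeterminate and constant polynomials \<open>w i\<close>.\<close>

lemma coeff_prod_linear_factors:
  fixes y :: "nat \<Rightarrow> 'a::comm_ring_1"
  assumes "k \<le> n"
  shows "coeff (\<Prod>i=1..n. [:- y i, 1:]) (n - k) = (-1) ^ k * elem_sym n y k"
proof -
  have "(\<Prod>i=1..n. [:- y i, 1:]) = (\<Prod>i=1..n. monom 1 1 - [:y i:])"
    by (simp add: monom_altdef)
  also have "\<dots> = (\<Sum>j\<le>n. (-1) ^ j * [:elem_sym n y j:] * monom 1 1 ^ (n - j))"
    by (simp only: prod_diff_eq_elem_sym elem_sym_const_poly)
  also have "\<dots> = (\<Sum>j\<le>n. monom ((-1) ^ j * elem_sym n y j) (n - j))"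
  proof (intro sum.cong refl)
    fix j
    have "(-1) ^ j = [:(-1 :: 'a) ^ j:]"
      by (induction j) (simp_all add: one_pCons)
    then show "(-1) ^ j * [:elem_sym n y j:] * monom 1 1 ^ (n - j) =
        monom ((-1) ^ j * elem_sym n y j) (n - j)"
      by (simp add: monom_power smult_monom mult.commute)
  qed
  also have "coeff \<dots> (n - k) = (-1) ^ k * elem_sym n y k"
    using assms by (rule coeff_sum_monom_diff)
  finally show ?thesis .
qed

text \<open>The prescribed values are, up to sign, the coefficients of a monic polynomial, and its
  linear factors supply \<open>y\<close>.\<close>

lemma elem_sym_surj:
  fixes s :: "nat \<Rightarrow> 'a::alg_closed_field"
  obtains y where "\<And>k. k \<in> {1..n} \<Longrightarrow> elem_sym n y k = s k"
proof -
  \<comment> \<open>The case \<open>k = 0\<close> makes \<open>p\<close> monic whatever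
    \<open>s 0\<close> is.\<close>
  define p where "p = (\<Sum>k\<le>n. monom ((-1) ^ k * (if k = 0 then 1 else s k)) (n - k))"
  have c: "coeff p (n - k) = (-1) ^ k * s k" if "k \<in> {1..n}" for k
    unfolding p_def using that by (subst coeff_sum_monom_diff) auto
  have cn: "coeff p n = 1"
    unfolding p_def
    using coeff_sum_monom_diff[of 0 n "\<lambda>k. (-1) ^ k * (if k = 0 then 1 else s k)"] by simp
  have "degree p \<le> n"
    unfolding p_def by (rule degree_sum_monom_diff_le)
  with cn have deg: "degree p = n"
    by (metis le_antisym le_degree zero_neq_one)
  with cn have "p \<noteq> 0" "lead_coeff p = 1" by auto
  with alg_closed_imp_factorization[of p] deg obtain A
    where A: "size A = n" "p = (\<Prod>x\<in>#A. [:- x, 1:])" by auto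
  obtain xs where xs: "mset xs = A" using ex_mset by blast
  define y where "y i = xs ! (i - 1)" for i
  have "p = prod_list (map (\<lambda>x. [:- x, 1:]) xs)"
    by (simp add: A(2) prod_mset_prod_list del: mset_map flip: xs mset_map)
  also have "\<dots> = (\<Prod>i=0..<n. [:- xs ! i, 1:])"
    using A(1) xs by (subst prod.list_conv_set_nth) auto
  also have "\<dots> = (\<Prod>i=1..n. [:- y i, 1:])"
    by (rule prod.reindex_bij_witness[of _ "\<lambda>i. i - 1" Suc]) (auto simp: y_def)
  finally have p: "p = (\<Prod>i=1..n. [:- y i, 1:])" .
  have "elem_sym n y k = s k" if "k \<in> {1..n}" for k
  proof -
    have "(-1) ^ k * elem_sym n y k = (-1) ^ k * s k"
      using coeff_prod_linear_factors[of k n y] c[OF that] that by (simp add: p)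
    then show ?thesis by simp
  qed
  then show ?thesis by (rule that)
qed

text \<open>
  With \<open>F = (\<Prod>i. 1 - y i X)\<close> and \<open>P = (\<Sum>i. y i X / (1 - y i X))\<close>, the generating function of the
  power sums, Newton's identities are the coefficients of \<open>F P = - X F'\<close>.
\<close>

lemma newton_identity:
  fixes y :: "nat \<Rightarrow> 'a::comm_ring_1" and n :: nat
  defines "P \<equiv> \<lambda>r. if r = 0 then 0 else \<Sum>i=1..n. y i ^ r"
  shows "(\<Sum>k\<le>r. (-1) ^ k * elem_sym n y k * P (r - k)) = - (of_nat r * (-1) ^ r * elem_sym n y r)"
proof -
  define g where "g i = Abs_fps (\<lambda>r. if r = 0 then 0 else y i ^ r)" for i
  define h where "h i = 1 - fps_const (y i) * fps_X" for i
  have gh: "h i * g i = fps_const (y i) * fps_X" for i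
    by (rule fps_ext, simp only: h_def left_diff_distrib mult.assoc)
       (auto simp: g_def power_eq_if)
  \<comment> \<open>The logarithmic derivative with denominators cleared: adjoining a factor is the
    product rule, since \<open>h a * g a\<close> is
    \<open>- fps_X * fps_deriv (h a)\<close>.\<close>
  have main: "(\<Prod>i\<in>A. h i) * (\<Sum>i\<in>A. g i) = - (fps_X * fps_deriv (\<Prod>i\<in>A. h i))"
    if "finite A" for A
    using that
  proof (induction A)
    case (insert a A)
    let ?F = "\<Prod>i\<in>A. h i"
    have "(\<Prod>i\<in>insert a A. h i) * (\<Sum>i\<in>insert a A. g i) =
        h a * g a * ?F + h a * (?F * (\<Sum>i\<in>A. g i))"
      using insert.hyps by (simp add: algebra_simps)
    also have "\<dots> = fps_const (y a) * fps_X * ?F - h a * (fps_X * fps_deriv ?F)"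
      by (simp only: gh insert.IH) simp
    also have "\<dots> = - (fps_X * (h a * fps_deriv ?F + fps_deriv (h a) * ?F))"
      by (simp add: h_def algebra_simps flip: fps_const_neg)
    also have "\<dots> = - (fps_X * fps_deriv (\<Prod>i\<in>insert a A. h i))"
      using insert.hyps by simp
    finally show ?case .
  qed auto
  have e: "elem_sym n (\<lambda>i. fps_const (y i)) k = fps_const (elem_sym n y k)" for k
  proof -
    have "(\<Prod>i\<in>A. fps_const (y i)) = fps_const (\<Prod>i\<in>A. y i)" for A
      by (induction A rule: infinite_finite_induct) auto
    moreover have "(\<Sum>A\<in>B. fps_const (f A)) = fps_const (\<Sum>A\<in>B. f A)" for B and f :: "nat set \<Rightarrow> 'a"
      by (induction B rule: infinite_finite_induct) auto
    ultimately show ?thesis by (simp add: elem_sym_def)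
  qed
  have "(\<Prod>i=1..n. h i) = (\<Sum>k\<le>n. (-1) ^ k * (fps_X ^ k * fps_const (elem_sym n y k)))"
    unfolding h_def using elem_sym_scale[of n fps_X "\<lambda>i. fps_const (y i)"]
    by (subst prod_diff_eq_elem_sym) (simp add: e mult.commute[of _ fps_X])
  also have "\<dots> = (\<Sum>k\<le>n. fps_const ((-1) ^ k * elem_sym n y k) * fps_X ^ k)"
  proof (intro sum.cong refl)
    fix k
    have "(-1) ^ k = fps_const ((-1 :: 'a) ^ k)"
      by (simp flip: fps_const_power fps_const_neg)
    then show "(-1) ^ k * (fps_X ^ k * fps_const (elem_sym n y k)) =
        fps_const ((-1) ^ k * elem_sym n y k) * fps_X ^ k"
      by (simp only: fps_const_mult[symmetric] mult_ac)
  qed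
  \<comment> \<open>For \<open>k > n\<close> both sides vanish, so the identities hold for every
    \<open>r\<close>, not only for \<open>r \<le> n\<close>.\<close>
  finally have F: "fps_nth (\<Prod>i=1..n. h i) k = (-1) ^ k * elem_sym n y k" for k
    by (cases "k \<le> n") (simp_all add: fps_sum_nth elem_sym_eq_0 if_distrib cong: if_cong)
  have G: "fps_nth (\<Sum>i=1..n. g i) k = P k" for k
    by (simp add: fps_sum_nth g_def P_def)
  have "(\<Sum>k\<le>r. (-1) ^ k * elem_sym n y k * P (r - k)) =
      fps_nth ((\<Prod>i=1..n. h i) * (\<Sum>i=1..n. g i)) r"
    unfolding fps_mult_nth F G atLeast0AtMost ..
  also have "\<dots> = - (of_nat r * (-1) ^ r * elem_sym n y r)"
    by (subst main) (auto simp: F[unfolded One_nat_def] mult.assoc)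
  finally show ?thesis .
qed

text \<open>The term \<open>k = 0\<close> of Newton's identity has coefficient 1, so the identity
  can be solved for the \<open>r\<close>-th power sum and strong induction applies. The exponent 0
  is separate because there the auxiliary \<open>P\<close> is 0 instead of \<open>n\<close>.\<close>

lemma mv_expressible_power_sum:
  "mv_expressible {1..n} (elem_sym n)
     (\<lambda>y :: nat \<Rightarrow> 'a::real_normed_field. \<Sum>i=1..n. y i ^ r)"
proof (cases "r = 0")
  case True
  then show ?thesis using mv_expressible_const[of "{1..n}" "elem_sym n" "real n"] by simp
next
  case False
  define P where "P r y = (if r = 0 then 0 else \<Sum>i=1..n. y i ^ r)" for r and y :: "nat \<Rightarrow> 'a"
  \<comment> \<open>For \<open>k > n\<close> there is no variable of index \<open>k\<close>, but
    then the elementary symmetric function is 0.\<close>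
  have var_mult: "mv_expressible {1..n} (elem_sym n) (\<lambda>y. of_real c * elem_sym n y k * g y)"
    if "mv_expressible {1..n} (elem_sym n) g" "k > 0" for g :: "(nat \<Rightarrow> 'a) \<Rightarrow> 'a" and c k
  proof (cases "k \<le> n")
    case True
    with that show ?thesis by (intro mv_expressible_cmult_var_mult) auto
  next
    case False
    then show ?thesis
      using mv_expressible_const[of "{1..n}" "elem_sym n" 0] by (simp add: elem_sym_eq_0)
  qed
  have "mv_expressible {1..n} (elem_sym n) (P r)" for r
  proof (induction r rule: less_induct)
    case (less r)
    show ?case
    proof (cases "r = 0")
      case True
      then show ?thesis
        using mv_expressible_const[of "{1..n}" "elem_sym n" 0] by (simp add: P_def[abs_def])
    next
      case False
      \<comment> \<open>The trailing \<open>of_real 1\<close> gives the first summand the shape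
        required by \<open>var_mult\<close>.\<close>
      have rec: "P r = (\<lambda>y. of_real (- (real r * (-1) ^ r)) * elem_sym n y r * of_real 1 +
          (\<Sum>k=1..r. of_real (- ((-1) ^ k)) * elem_sym n y k * P (r - k) y))"
      proof
        fix y
        have "{..r} = insert 0 {1..r}" by auto
        then show "P r y = of_real (- (real r * (-1) ^ r)) * elem_sym n y r * of_real 1 +
          (\<Sum>k=1..r. of_real (- ((-1) ^ k)) * elem_sym n y k * P (r - k) y)"
          using newton_identity[of n y r, folded P_def]
          by (simp add: elem_sym_0 sum_negf algebra_simps add_eq_0_iff2)
      qed
      show ?thesis
        unfolding rec using False
        by (intro mv_expressible_add mv_expressible_sum var_mult mv_expressible_const less.IH) auto
    qed
  qed
  from this[of r] False show ?thesis by (simp add: P_def[abs_def])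
qed

section \<open>The defining property of the mean power polynomial and of
  \<open>gen_cheb_T\<close>\<close>

lemma mean_power_poly_spec:
  assumes "n \<ge> 1"
  shows "mv_vars (mean_power_poly n r) \<subseteq> {1..n} \<and>
    (\<forall>y :: nat \<Rightarrow> complex.
       mv_eval (mean_power_poly n r) (elem_sym n y) = (\<Sum>i = 1..n. y i ^ r) / of_nat n)"
  unfolding mean_power_poly_def
proof (rule theI')
  let ?P = "\<lambda>p. mv_vars p \<subseteq> {1..n} \<and> (\<forall>y :: nat \<Rightarrow> complex.
       mv_eval p (elem_sym n y) = (\<Sum>i = 1..n. y i ^ r) / of_nat n)"
  \<comment> \<open>The factor \<open>1 / n\<close> is written as a multiple of the empty
    monomial.\<close>
  have "mv_expressible {1..n} (elem_sym n) (\<lambda>y :: nat \<Rightarrow> complex.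
          of_real (1 / real n) * mono_eval 0 (elem_sym n y) * (\<Sum>i=1..n. y i ^ r))"
    by (intro mv_expressible_mult_monomial mv_expressible_power_sum) auto
  then have ex: "\<exists>p. ?P p"
    by (simp add: mv_expressible_def mono_eval_def)
  have "p = q" if p: "?P p" and q: "?P q" for p q
  proof (rule mv_eval_inject)
    fix s :: "nat \<Rightarrow> complex"
    \<comment> \<open>On the variables that occur, any point \<open>s\<close> is a tuple of
      elementary symmetric functions, where both candidates are known.\<close>
    obtain y where y: "\<And>k. k \<in> {1..n} \<Longrightarrow> elem_sym n y k = s k"
      using elem_sym_surj[of n s] by blast
    have "mv_eval p s = mv_eval p (elem_sym n y)"
      using p by (intro mv_eval_cong[of p "{1..n}"]) (simp_all add: y)
    also have "\<dots> = mv_eval q (elem_sym n y)" using p q by simp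
    also have "\<dots> = mv_eval q s"
      using q by (intro mv_eval_cong[of q "{1..n}"]) (simp_all add: y)
    finally show "mv_eval p s = mv_eval q s" .
  qed
  with ex show "\<exists>!p. ?P p" by blast
qed

text \<open>The last argument 1 of \<open>gen_cheb_T\<close> stands for the product of the
  \<open>y i\<close>. The specification is over the complex numbers and is transferred to real
  \<open>y\<close> by injectivity of \<open>of_real\<close>.\<close>

lemma gen_cheb_T_eq_power_mean:
  assumes "n \<ge> 1" "elem_sym n y n = 1" "\<And>k. k \<in> {1..<n} \<Longrightarrow> s k = elem_sym n y k"
  shows "gen_cheb_T (n - 1) r s = (\<Sum>i=1..n. y i ^ r) / real n"
proof -
  let ?p = "mean_power_poly n r"
  have "gen_cheb_T (n - 1) r s = mv_eval ?p (s(n := 1))"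
    using assms(1) by (simp add: gen_cheb_T_def)
  also have "\<dots> = mv_eval ?p (elem_sym n y)"
    using mean_power_poly_spec[OF assms(1), of r] assms
    by (intro mv_eval_cong[of _ "{1..n}"]) auto
  finally have "complex_of_real (gen_cheb_T (n - 1) r s) =
      mv_eval ?p (elem_sym n (\<lambda>i. complex_of_real (y i)))"
    by (simp add: of_real_mv_eval of_real_elem_sym[abs_def])
  also have "\<dots> = complex_of_real ((\<Sum>i=1..n. y i ^ r) / real n)"
    using mean_power_poly_spec[OF assms(1), of r] by simp
  finally show ?thesis by (simp only: of_real_eq_iff)
qed

section \<open>Chebyshev polynomials\<close>

text \<open>
  For \<open>0 < 2 k \<le> N\<close> this is \<open>N / k\<close> times \<open>(N - k - 1) choose (k - 1)\<close>, written so that the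
  recursion in \<open>N\<close> is Pascal's rule. The guard suppresses the spurious value that truncated
  subtraction would give at \<open>N = k = 1\<close>.
\<close>

definition cheb_binom :: "nat \<Rightarrow> nat \<Rightarrow> nat" where
  "cheb_binom N k = (if N < 2 * k then 0
     else ((N - k) choose k) + (if k = 0 then 0 else ((N - k - 1) choose (k - 1))))"

lemma cheb_binom_0 [simp]: "cheb_binom N 0 = 1"
  by (simp add: cheb_binom_def)

lemma cheb_binom_eq_0 [simp]: "N < 2 * k \<Longrightarrow> cheb_binom N k = 0"
  by (simp add: cheb_binom_def)

text \<open>This is the Chebyshev recursion read on coefficients. It fails for \<open>N = 0\<close>,
  where \<open>2 T_0 = 2\<close> but \<open>cheb_binom 0 0 = 1\<close>.\<close>

lemma cheb_binom_rec:
  assumes "N \<ge> 1"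
  shows "cheb_binom (Suc (Suc N)) (Suc k) = cheb_binom (Suc N) (Suc k) + cheb_binom N k"
proof -
  consider "N < 2 * k" | "N = 2 * k" | j where "N = Suc (2 * k + j)"
    by (metis add_Suc_right less_iff_Suc_add nat_neq_iff)
  then show ?thesis
  proof cases
    case 2
    with assms show ?thesis by (cases k) (simp_all add: cheb_binom_def)
  next
    case 3
    then have N: "N - k = Suc (k + j)" "Suc N - k = Suc (Suc (k + j))" by auto
    from 3 show ?thesis
      by (cases k) (simp_all add: cheb_binom_def N Suc_diff_le)
  qed simp
qed

text \<open>Absorption, \<open>k (m+1 choose k) = (m+1) (m choose k-1)\<close>, merges the two
  binomials into the form used in the theorem.\<close>

lemma cheb_binom_closed:
  assumes "k \<ge> 1" "2 * k \<le> N"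
  shows "real (cheb_binom N k) = real N / real k * real ((N - k - 1) choose (k - 1))"
proof -
  obtain k' where k: "k = Suc k'" using assms(1) by (cases k) auto
  obtain m where m: "N - k = Suc m" using assms by (cases "N - k") auto
  have N: "N = k + Suc m" using assms m by linarith
  have "Suc k' * (Suc m choose Suc k') = Suc m * (m choose k')"
    by (subst Suc_times_binomial_eq) (rule mult.commute)
  then have "real k * real (Suc m choose k) = real (Suc m) * real (m choose k')"
    unfolding k by (metis of_nat_mult)
  then have "real k * real (cheb_binom N k) = real N * real (m choose k')"
    using assms by (simp add: cheb_binom_def m k N algebra_simps)
  then show ?thesis using assms(1) m k by (simp add: field_simps)
qed

text \<open>Summing up to \<open>N\<close> instead of \<open>N div 2\<close> only adds zero terms
  and keeps the index ranges aligned in the recursion.\<close>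

lemma cheb_T_explicit:
  assumes "N \<ge> 1"
  shows "2 * poly (cheb_T N) x =
    (\<Sum>k\<le>N. (-1) ^ k * real (cheb_binom N k) * (2 * x) ^ (N - 2 * k))"
  using assms
proof (induction N rule: cheb_T.induct)
  case (3 n)
  show ?case
  proof (cases "n = 0")
    case True
    then show ?thesis
      by (simp add: cheb_binom_def numeral_2_eq_2)
  next
    case False
    let ?S = "\<lambda>N. \<Sum>k\<le>N. (-1) ^ k * real (cheb_binom N k) * (2 * x) ^ (N - 2 * k)"
    have S1: "2 * x * ?S (Suc n) = (2 * x) ^ Suc (Suc n) +
        (\<Sum>k\<le>Suc n. (-1) ^ Suc k * real (cheb_binom (Suc n) (Suc k)) * (2 * x) ^ (n - 2 * k))"
    proof -
      have "2 * x * ?S (Suc n) = (\<Sum>k\<le>Suc (Suc n). 2 * x *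
          ((-1) ^ k * real (cheb_binom (Suc n) k) * (2 * x) ^ (Suc n - 2 * k)))"
        by (subst sum.atMost_Suc) (simp add: sum_distrib_left)
      also have "\<dots> = (2 * x) ^ Suc (Suc n) + (\<Sum>k\<le>Suc n. 2 * x *
          ((-1) ^ Suc k * real (cheb_binom (Suc n) (Suc k)) * (2 * x) ^ (Suc n - 2 * Suc k)))"
        by (subst sum.atMost_Suc_shift) simp
      also have "(\<Sum>k\<le>Suc n. 2 * x *
          ((-1) ^ Suc k * real (cheb_binom (Suc n) (Suc k)) * (2 * x) ^ (Suc n - 2 * Suc k))) =
        (\<Sum>k\<le>Suc n. (-1) ^ Suc k * real (cheb_binom (Suc n) (Suc k)) * (2 * x) ^ (n - 2 * k))"
      proof (intro sum.cong refl)
        fix k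
        show "2 * x * ((-1) ^ Suc k * real (cheb_binom (Suc n) (Suc k)) *
            (2 * x) ^ (Suc n - 2 * Suc k)) =
          (-1) ^ Suc k * real (cheb_binom (Suc n) (Suc k)) * (2 * x) ^ (n - 2 * k)"
        \<comment> \<open>Otherwise truncated subtraction spoils the exponents, but then
          \<open>cheb_binom (Suc n) (Suc k)\<close> is 0.\<close>
        proof (cases "2 * k < n")
          case True
          then have "n - 2 * k = Suc (Suc n - 2 * Suc k)" by simp
          then show ?thesis by (simp only: power_Suc mult_ac)
        qed simp
      qed
      finally show ?thesis .
    qed
    have S0: "?S n = (\<Sum>k\<le>Suc n. (-1) ^ k * real (cheb_binom n k) * (2 * x) ^ (n - 2 * k))"
      by simp
    have "2 * poly (cheb_T (Suc (Suc n))) x = 2 * x * ?S (Suc n) - ?S n"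
      using "3.IH" False by (simp add: algebra_simps)
    also have "\<dots> = (2 * x) ^ Suc (Suc n) +
        (\<Sum>k\<le>Suc n. (-1) ^ Suc k * real (cheb_binom (Suc (Suc n)) (Suc k)) * (2 * x) ^ (n - 2 * k))"
      unfolding S1 S0 add_diff_eq[symmetric] sum_subtractf[symmetric] using False
      by (intro arg_cong2[where f = "(+)"] sum.cong refl) (simp add: cheb_binom_rec algebra_simps)
    also have "\<dots> = ?S (Suc (Suc n))"
      by (subst (2) sum.atMost_Suc_shift) simp
    finally show ?thesis .
  qed
qed (simp_all add: cheb_binom_def)

lemma poly_cheb_T_cos: "poly (cheb_T n) (cos t) = cos (real n * t)"
proof (induction n rule: cheb_T.induct)
  case (3 n)
  have "cos (real (Suc (Suc n)) * t) = cos (real (Suc n) * t + t)"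
    and "cos (real n * t) = cos (real (Suc n) * t - t)"
    by (simp_all add: algebra_simps)
  then have "cos (real (Suc (Suc n)) * t) = 2 * cos t * cos (real (Suc n) * t) - cos (real n * t)"
    by (simp only: cos_add cos_diff) (simp add: algebra_simps)
  with 3 show ?case by simp
qed simp_all

section \<open>Positive zeros of the Chebyshev polynomials and the polynomial of their
  squares\<close>

definition cheb_node :: "nat \<Rightarrow> nat \<Rightarrow> real" where
  "cheb_node N i = cos (real (2 * i - 1) / real (2 * N) * pi)"

text \<open>For these indices \<open>2 * i - 1 < N\<close>; for odd \<open>N\<close> the next index
  would give the zero at the origin.\<close>

lemma cheb_node_angle:
  assumes "i \<in> {1..N div 2}"
  shows "real (2 * i - 1) / real (2 * N) * pi \<in> {0<..<pi / 2}"
proof -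
  from assms have "real (2 * i - 1) < real N" "real (2 * i - 1) > 0" by auto
  then have "0 < real (2 * i - 1) / real (2 * N)" "real (2 * i - 1) / real (2 * N) < 1 / 2"
    by (simp_all add: divide_simps)
  then have "real (2 * i - 1) / real (2 * N) * pi < 1 / 2 * pi"
    and "0 < real (2 * i - 1) / real (2 * N) * pi"
    by (simp_all only: mult_strict_right_mono mult_pos_pos pi_gt_zero)
  then show ?thesis
    by (simp only: greaterThanLessThan_iff times_divide_eq_left mult_1 simp_thms)
qed

lemma cheb_node_pos: "i \<in> {1..N div 2} \<Longrightarrow> cheb_node N i > 0"
  unfolding cheb_node_def using cheb_node_angle by (intro cos_gt_zero) auto

lemma cheb_T_node:
  assumes "i \<in> {1..N div 2}"
  shows "poly (cheb_T N) (cheb_node N i) = 0"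
proof -
  from assms have "2 * i - 1 = Suc (2 * (i - 1))" "N > 0" by auto
  then have "real N * (real (2 * i - 1) / real (2 * N) * pi) = pi * real (Suc (2 * (i - 1))) / 2"
    by (simp add: field_simps)
  then show ?thesis
    unfolding cheb_node_def poly_cheb_T_cos by (simp only: cos_pi_eq_zero)
qed

text \<open>Positivity recovers a node from its square, and cosine is injective on the range of the
  angles.\<close>

lemma inj_on_cheb_node_power2: "inj_on (\<lambda>i. cheb_node N i ^ 2) {1..N div 2}"
proof (rule inj_onI)
  fix i j assume ij: "i \<in> {1..N div 2}" "j \<in> {1..N div 2}" "cheb_node N i ^ 2 = cheb_node N j ^ 2"
  define \<theta> where "\<theta> i = real (2 * i - 1) / real (2 * N) * pi" for i
  have "cheb_node N i = cheb_node N j"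
    using ij(3) by (rule power2_eq_imp_eq) (rule less_imp_le, rule cheb_node_pos, rule ij)+
  then have "cos (\<theta> i) = cos (\<theta> j)"
    unfolding cheb_node_def \<theta>_def .
  moreover have "\<theta> i \<in> {0<..<pi / 2}" "\<theta> j \<in> {0<..<pi / 2}"
    unfolding \<theta>_def using cheb_node_angle[OF ij(1)] cheb_node_angle[OF ij(2)] .
  ultimately have "\<theta> i = \<theta> j"
    using cos_inj_pi[of "\<theta> i" "\<theta> j"] pi_gt_zero
    unfolding greaterThanLessThan_iff by linarith
  then have "real (2 * i - 1) / real (2 * N) = real (2 * j - 1) / real (2 * N)"
    unfolding \<theta>_def by (simp only: mult_right_cancel[OF pi_neq_zero])
  moreover have "N \<noteq> 0" using ij(1) by (intro notI) simp
  then have "real (2 * N) \<noteq> 0" by simp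
  ultimately have "2 * i - 1 = 2 * j - 1"
    by (simp only: divide_cancel_right of_nat_eq_iff simp_thms)
  moreover have "i \<ge> 1" "j \<ge> 1" using ij by auto
  ultimately show "i = j" by linarith
qed

text \<open>The monic polynomial \<open>U\<close> of the overview; \<open>4 ^ k\<close> is the
  quotient of \<open>2 ^ N\<close> by \<open>2 ^ (N - 2 * k)\<close>.\<close>

definition cheb_half_poly :: "nat \<Rightarrow> real poly" where
  "cheb_half_poly N =
     (\<Sum>k\<le>N div 2. monom ((-1) ^ k * (real (cheb_binom N k) / 4 ^ k)) (N div 2 - k))"

lemma poly_cheb_T_conv_half:
  assumes "N \<ge> 1"
  shows "poly (cheb_T N) x = 2 ^ (N - 1) * x ^ (N mod 2) * poly (cheb_half_poly N) (x ^ 2)"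
proof -
  have "2 * poly (cheb_T N) x =
      (\<Sum>k\<le>N div 2. (-1) ^ k * real (cheb_binom N k) * (2 * x) ^ (N - 2 * k))"
    unfolding cheb_T_explicit[OF assms] by (intro sum.mono_neutral_right) auto
  also have "\<dots> = (\<Sum>k\<le>N div 2. 2 ^ N * x ^ (N mod 2) *
      ((-1) ^ k * (real (cheb_binom N k) / 4 ^ k) * (x ^ 2) ^ (N div 2 - k)))"
  proof (intro sum.cong refl)
    fix k assume "k \<in> {..N div 2}"
    then have k: "2 * k \<le> N" by auto
    have e: "N - 2 * k = N mod 2 + 2 * (N div 2 - k)"
      using k by presburger
    have "(2 :: real) ^ (N - 2 * k) * 4 ^ k = 2 ^ (N - 2 * k + 2 * k)"
      by (simp only: power_add power_mult) simp
    also have "\<dots> = 2 ^ N" using k by (simp only: le_add_diff_inverse2)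
    finally have "(2 :: real) ^ N = 2 ^ (N - 2 * k) * 4 ^ k" ..
    moreover have "(2 * x) ^ (N - 2 * k) =
        2 ^ (N - 2 * k) * (x ^ (N mod 2) * (x ^ 2) ^ (N div 2 - k))"
      unfolding power_mult_distrib by (subst (2) e) (simp only: power_add power_mult)
    ultimately show "(-1) ^ k * real (cheb_binom N k) * (2 * x) ^ (N - 2 * k) =
      2 ^ N * x ^ (N mod 2) *
      ((-1) ^ k * (real (cheb_binom N k) / 4 ^ k) * (x ^ 2) ^ (N div 2 - k))"
      by simp
  qed
  also have "\<dots> = 2 ^ N * x ^ (N mod 2) * poly (cheb_half_poly N) (x ^ 2)"
    by (simp add: cheb_half_poly_def poly_sum poly_monom sum_distrib_left)
  finally show ?thesis using assms by (cases N) auto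
qed

text \<open>Both sides have degree at most \<open>N div 2\<close>, the same coefficient there, and
  \<open>N div 2\<close> common distinct zeros.\<close>

lemma cheb_half_poly_eq_prod:
  assumes "N \<ge> 1"
  shows "cheb_half_poly N = (\<Prod>i=1..N div 2. [:- (cheb_node N i ^ 2), 1:])"
proof (rule poly_eqI_degree_lead_coeff)
  let ?M = "N div 2" and ?y = "\<lambda>i. cheb_node N i ^ 2"
  show "coeff (cheb_half_poly N) ?M = coeff (\<Prod>i=1..?M. [:- ?y i, 1:]) ?M"
    using coeff_sum_monom_diff[of 0 ?M "\<lambda>k. (-1) ^ k * (real (cheb_binom N k) / 4 ^ k)"]
      coeff_prod_linear_factors[of 0 ?M ?y]
    by (simp add: cheb_half_poly_def elem_sym_0)
  show "?M \<le> card (?y ` {1..?M})"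
    unfolding card_image[OF inj_on_cheb_node_power2] by simp
  show "degree (cheb_half_poly N) \<le> ?M"
    unfolding cheb_half_poly_def by (rule degree_sum_monom_diff_le)
  show "degree (\<Prod>i=1..?M. [:- ?y i, 1:]) \<le> ?M"
    by (rule order.trans[OF degree_prod_sum_le]) auto
  fix z assume "z \<in> ?y ` {1..?M}"
  then obtain i where i: "i \<in> {1..?M}" "z = ?y i" by blast
  have "poly (cheb_half_poly N) z = 0"
    using cheb_T_node[OF i(1)] cheb_node_pos[OF i(1)]
    by (simp add: poly_cheb_T_conv_half[OF assms] i(2))
  moreover have "poly (\<Prod>i=1..?M. [:- ?y i, 1:]) z = 0"
    using i by (auto simp: poly_prod)
  ultimately show "poly (cheb_half_poly N) z = poly (\<Prod>i=1..?M. [:- ?y i, 1:]) z" by simp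
qed

lemma elem_sym_cheb_node_power2:
  assumes "N \<ge> 1" "k \<le> N div 2"
  shows "elem_sym (N div 2) (\<lambda>i. cheb_node N i ^ 2) k = real (cheb_binom N k) / 4 ^ k"
proof -
  have "(-1) ^ k * elem_sym (N div 2) (\<lambda>i. cheb_node N i ^ 2) k =
      coeff (cheb_half_poly N) (N div 2 - k)"
    unfolding cheb_half_poly_eq_prod[OF assms(1)]
    by (rule coeff_prod_linear_factors[OF assms(2), symmetric])
  also have "\<dots> = (-1) ^ k * (real (cheb_binom N k) / 4 ^ k)"
    unfolding cheb_half_poly_def by (rule coeff_sum_monom_diff[OF assms(2)])
  finally show ?thesis by (simp only: mult_cancel_left) simp
qed

text \<open>Splitting each factor \<open>x^2 - a^2\<close> exhibits all zeros with multiplicity, so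
  that \<open>proots\<close> can be computed.\<close>

lemma cheb_T_factorization:
  assumes "N \<ge> 1"
  shows "cheb_T N = smult (2 ^ (N - 1)) ([:0, 1:] ^ (N mod 2) *
    (\<Prod>i=1..N div 2. [:- cheb_node N i, 1:] * [:cheb_node N i, 1:]))"
    (is "_ = ?q")
proof -
  have "poly (cheb_T N) x = poly ?q x" for x
    by (simp add: poly_cheb_T_conv_half[OF assms] cheb_half_poly_eq_prod[OF assms] poly_prod
        power2_eq_square algebra_simps)
  then show ?thesis by (simp add: poly_eq_poly_eq_iff[symmetric] fun_eq_iff)
qed

section \<open>Moments of the zeros\<close>

lemma sum_proots_prod:
  assumes "\<And>i. i \<in> A \<Longrightarrow> f i \<noteq> 0"
  shows "(\<Sum>x\<in>#proots (\<Prod>i\<in>A. f i). g x) = (\<Sum>i\<in>A. \<Sum>x\<in>#proots (f i). g x)"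
  using assms by (induction A rule: infinite_finite_induct) (auto simp: proots_mult)

lemma cheb_moment_eq:
  assumes "N \<ge> 1"
  shows "cheb_moment r N = (real (N mod 2) * 0 ^ r +
    (\<Sum>i=1..N div 2. cheb_node N i ^ r + (- cheb_node N i) ^ r)) / real N"
proof -
  let ?x = "cheb_node N"
  have pair: "(\<Sum>x\<in>#proots ([:- a, 1:] * [:a, 1:]). x ^ r) = a ^ r + (- a) ^ r" for a :: real
    by (subst proots_mult) simp_all
  have nz: "(\<Prod>i=1..N div 2. [:- ?x i, 1:] * [:?x i, 1:]) \<noteq> 0" by simp
  have "(\<Sum>x\<in>#proots (cheb_T N). x ^ r) = (\<Sum>x\<in>#proots ([:0, 1:] ^ (N mod 2)). x ^ r) +
      (\<Sum>x\<in>#proots (\<Prod>i=1..N div 2. [:- ?x i, 1:] * [:?x i, 1:]). x ^ r)"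
    unfolding cheb_T_factorization[OF assms] using nz by (simp add: proots_mult)
  also have "(\<Sum>x\<in>#proots ([:0, 1 :: real:] ^ (N mod 2)). x ^ r) = real (N mod 2) * 0 ^ r"
    by (cases "N mod 2 = 0") (auto simp: mod_2_eq_odd)
  also have "(\<Sum>x\<in>#proots (\<Prod>i=1..N div 2. [:- ?x i, 1:] * [:?x i, 1:]). x ^ r) =
      (\<Sum>i=1..N div 2. ?x i ^ r + (- ?x i) ^ r)"
    by (subst sum_proots_prod) (simp_all only: pair, simp)
  finally show ?thesis by (simp add: cheb_moment_def)
qed

lemma cheb_moment_even:
  assumes "N \<ge> 1" "l \<ge> 1"
  shows "cheb_moment (2 * l) N = 2 / real N * (\<Sum>i=1..N div 2. cheb_node N i ^ (2 * l))"
  using assms by (simp add: cheb_moment_eq power_0_left flip: sum_distrib_left)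

text \<open>Multiplying the squared nodes by \<open>4 / q\<close> turns their product
  \<open>cheb_binom N M / 4 ^ M\<close>, with \<open>M = N div 2\<close>, into 1. The parity of
  \<open>N\<close> only affects the choice of \<open>q\<close>.\<close>

lemma cheb_moment_conv_gen_cheb_T:
  assumes "N \<ge> 2" "l \<ge> 1" "q > 0" "q ^ (N div 2) = real (cheb_binom N (N div 2))"
    and s: "\<And>k. k \<in> {1..<N div 2} \<Longrightarrow> s k = real (cheb_binom N k) / q ^ k"
  shows "cheb_moment (2 * l) N =
    real (2 * (N div 2)) / real N * (q / 4) ^ l * gen_cheb_T (N div 2 - 1) l s"
proof -
  let ?M = "N div 2" and ?z = "\<lambda>i. 4 / q * cheb_node N i ^ 2"
  have e: "elem_sym ?M ?z k = real (cheb_binom N k) / q ^ k" if "k \<le> ?M" for k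
    using elem_sym_cheb_node_power2[of N k] that assms(1)
    unfolding elem_sym_scale by (simp add: power_divide)
  have pos: "real (cheb_binom N ?M) > 0"
    using assms(3) by (simp only: assms(4)[symmetric] zero_less_power)
  have "gen_cheb_T (?M - 1) l s = (\<Sum>i=1..?M. ?z i ^ l) / real ?M"
    using assms e pos by (intro gen_cheb_T_eq_power_mean) auto
  also have "(\<Sum>i=1..?M. ?z i ^ l) = (4 / q) ^ l * (\<Sum>i=1..?M. cheb_node N i ^ (2 * l))"
    by (simp only: power_mult_distrib power_mult sum_distrib_left)
  finally show ?thesis
    using assms(1-3) by (simp add: cheb_moment_even power_divide)
qed

theorem mainTheorem2:
  shows
    "(\<forall>N\<ge>1. \<forall>l\<ge>1. cheb_moment (2 * l) N =
        2 / real N *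
        (\<Sum>k = 1..N div 2. cos (real (2 * k - 1) / real (2 * N) * pi) ^ (2 * l))) \<and>
     (\<forall>l\<ge>1. \<forall>M\<ge>1. cheb_moment (2 * l) (2 * M) =
        2 powr (- ((2 - 1 / real M) * real l)) *
        gen_cheb_T (M - 1) l
          (\<lambda>k. real (2 * M) / real k * 2 powr (- (real k / real M)) *
                real ((2 * M - k - 1) choose (k - 1)))) \<and>
     (\<forall>l\<ge>1. \<forall>M\<ge>1. cheb_moment (2 * l) (2 * M + 1) =
        real (2 * M) / real (2 * M + 1) *
        (real (2 * M + 1) powr (1 / real M) / 4) ^ l *
        gen_cheb_T (M - 1) l
          (\<lambda>k. real (2 * M + 1) / real k *
                (1 / real (2 * M + 1) powr (real k / real M)) *
                real ((2 * M - k) choose (k - 1)))) \<and>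
     (\<forall>N\<ge>1. cheb_moment 0 N = 1) \<and>
     (\<forall>l\<ge>1. cheb_moment (2 * l) 1 = 0)"
proof (intro conjI allI impI)
  fix N l :: nat assume "N \<ge> 1" "l \<ge> 1"
  then show "cheb_moment (2 * l) N = 2 / real N *
      (\<Sum>k = 1..N div 2. cos (real (2 * k - 1) / real (2 * N) * pi) ^ (2 * l))"
    by (simp only: cheb_moment_even cheb_node_def)
next
  fix l M :: nat assume l: "l \<ge> 1" and M: "M \<ge> 1"
  define q :: real where "q = 2 powr (1 / real M)"
  have q: "q > 0" "q ^ k = 2 powr (real k / real M)" for k
    by (simp_all add: q_def powr_realpow[symmetric] powr_powr)
  have "cheb_moment (2 * l) (2 * M) =
      real (2 * (2 * M div 2)) / real (2 * M) * (q / 4) ^ l * gen_cheb_T (2 * M div 2 - 1) l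
        (\<lambda>k. real (2 * M) / real k * 2 powr (- (real k / real M)) *
                real ((2 * M - k - 1) choose (k - 1)))"
  proof (rule cheb_moment_conv_gen_cheb_T)
    \<comment> \<open>The constant coefficient \<open>cheb_binom (2 * M) M\<close> is 2, whence the
      choice of \<open>q\<close>.\<close>
    show "q ^ (2 * M div 2) = real (cheb_binom (2 * M) (2 * M div 2))"
      using M by (simp add: q cheb_binom_def)
  qed (use l M in \<open>auto simp: q cheb_binom_closed powr_minus divide_simps\<close>)
  also have "(q / 4) ^ l = 2 powr (- ((2 - 1 / real M) * real l))"
  proof -
    have "q / 4 = 2 powr (1 / real M - 2)"
      by (simp add: q_def powr_diff)
    then have "(q / 4) ^ l = 2 powr ((1 / real M - 2) * real l)"
      by (simp add: powr_realpow[symmetric] powr_powr)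
    then show ?thesis by (simp add: algebra_simps)
  qed
  finally show "cheb_moment (2 * l) (2 * M) =
      2 powr (- ((2 - 1 / real M) * real l)) * gen_cheb_T (M - 1) l
        (\<lambda>k. real (2 * M) / real k * 2 powr (- (real k / real M)) *
                real ((2 * M - k - 1) choose (k - 1)))"
    using M by simp
next
  fix l M :: nat assume l: "l \<ge> 1" and M: "M \<ge> 1"
  define q where "q = real (2 * M + 1) powr (1 / real M)"
  have q: "q > 0" "q ^ k = real (2 * M + 1) powr (real k / real M)" for k
    by (simp_all add: q_def powr_realpow[symmetric] powr_powr)
  have half: "(2 * M + 1) div 2 = M" by simp
  have "cheb_moment (2 * l) (2 * M + 1) =
      real (2 * ((2 * M + 1) div 2)) / real (2 * M + 1) * (q / 4) ^ l *
      gen_cheb_T ((2 * M + 1) div 2 - 1) l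
        (\<lambda>k. real (2 * M + 1) / real k * (1 / real (2 * M + 1) powr (real k / real M)) *
                real ((2 * M - k) choose (k - 1)))"
  proof (rule cheb_moment_conv_gen_cheb_T)
    \<comment> \<open>Here \<open>cheb_binom (2 * M + 1) M\<close> equals \<open>2 * M + 1\<close>,
      by the closed form and \<open>M choose (M - 1) = M\<close>.\<close>
    show "q ^ ((2 * M + 1) div 2) = real (cheb_binom (2 * M + 1) ((2 * M + 1) div 2))"
    proof -
      have "M choose (M - 1) = M" using M by (cases M) auto
      then show ?thesis using M by (simp only: half q) (simp add: cheb_binom_closed)
    qed
    fix k assume "k \<in> {1..<(2 * M + 1) div 2}"
    then show "real (2 * M + 1) / real k * (1 / real (2 * M + 1) powr (real k / real M)) *
        real ((2 * M - k) choose (k - 1)) = real (cheb_binom (2 * M + 1) k) / q ^ k"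
      by (simp add: q cheb_binom_closed)
  qed (use l M q in auto)
  then show "cheb_moment (2 * l) (2 * M + 1) =
      real (2 * M) / real (2 * M + 1) * (real (2 * M + 1) powr (1 / real M) / 4) ^ l *
      gen_cheb_T (M - 1) l
        (\<lambda>k. real (2 * M + 1) / real k * (1 / real (2 * M + 1) powr (real k / real M)) *
                real ((2 * M - k) choose (k - 1)))"
    by (simp only: half q_def)
next
  fix N :: nat assume "N \<ge> 1"
  moreover have "real (N mod 2) + real (N div 2) * 2 = real N"
    by (metis mod_mult_div_eq mult.commute of_nat_add of_nat_mult of_nat_numeral)
  \<comment> \<open>With \<open>0 ^ 0 = 1\<close> the zero at the origin is counted for odd
    \<open>N\<close>, so the sum is the number of zeros.\<close>
  ultimately show "cheb_moment 0 N = 1"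
    by (simp add: cheb_moment_eq)
next
  fix l :: nat assume "l \<ge> 1"
  \<comment> \<open>The range \<open>{1..1 div 2}\<close> is empty.\<close>
  then show "cheb_moment (2 * l) 1 = 0" by (simp add: cheb_moment_even)
qed

end
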